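(* For every prime $p$, there exists a finitely generated infinite residually finite $p$-group $Q$ with positive rank gradient, i.e. with $\mathrm{RG}(Q)>0$.
   Context: For a finitely generated group $G$, let $d(G)$ denote the minimal number of generators of $G$. The rank gradient of a finitely generated group $G$ is $$\mathrm{RG}(G)=\inf_{[G:H]<\infty}\frac{d(H)-1}{[G:H]},$$ where the infimum is taken over all finite index subgroups $H\le G$. A $p$-group is a (possibly infinite) group in which every element has order a power of $p$. *)

theory Defs
  imports Complex_Main "HOL-Computational_Algebra.Primes" "HOL-Algebra.Generated_Groups" "HOL-Algebra.Multiplicative_Group"
begin

definition finitely_generated_group :: "('a, 'b) monoid_scheme \<Rightarrow> bool" where
  "finitely_generated_group G \<longleftrightarrow>
     group G \<and> (\<exists>S. finite S \<and> S \<subseteq> carrier G \<and> generate G S = carrier G)"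

text \<open>Only meaningful for finitely generated groups.\<close>

definition min_generators :: "('a, 'b) monoid_scheme \<Rightarrow> nat" where
  "min_generators G =
     (LEAST n. \<exists>S. finite S \<and> card S = n \<and> S \<subseteq> carrier G \<and> generate G S = carrier G)"

definition finite_index_subgroup :: "'a set \<Rightarrow> ('a, 'b) monoid_scheme \<Rightarrow> bool" where
  "finite_index_subgroup H G \<longleftrightarrow> subgroup H G \<and> finite (rcosets\<^bsub>G\<^esub> H)"

definition subgroup_index :: "('a, 'b) monoid_scheme \<Rightarrow> 'a set \<Rightarrow> nat" where
  "subgroup_index G H = card (rcosets\<^bsub>G\<^esub> H)"

text \<open>
  For a finitely generated group every finite index subgroup is again finitely generated, so
  \<^const>\<open>min_generators\<close> is meaningful on all of them. The subtraction is on the reals (the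
  trivial subgroup contributes a negative value); all quotients are at least -1, and the whole
  group contributes one of them, so the infimum of reals is a genuine one.
\<close>

definition rank_gradient :: "('a, 'b) monoid_scheme \<Rightarrow> real" where
  "rank_gradient G =
     (INF H \<in> {H. finite_index_subgroup H G}.
        (real (min_generators (G\<lparr>carrier := H\<rparr>)) - 1) / real (subgroup_index G H))"

definition residually_finite :: "('a, 'b) monoid_scheme \<Rightarrow> bool" where
  "residually_finite G \<longleftrightarrow>
     group G \<and>
     (\<forall>x \<in> carrier G. x \<noteq> \<one>\<^bsub>G\<^esub> \<longrightarrow>
        (\<exists>N. N \<lhd> G \<and> finite (rcosets\<^bsub>G\<^esub> N) \<and> x \<notin> N))"

text \<open>
  \<^const>\<open>group.ord\<close> is 0 on elements of infinite order, which are therefore excluded when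
  \<open>p\<close> is prime.
\<close>

definition p_group :: "nat \<Rightarrow> ('a, 'b) monoid_scheme \<Rightarrow> bool" where
  "p_group p G \<longleftrightarrow> group G \<and> (\<forall>x \<in> carrier G. \<exists>k::nat. group.ord G x = p ^ k)"

end

theory Submission
  imports Defs "HOL-Library.Countable"
begin

text \<open>
  Take words in two letters, and call a finite action of the letters admissible if every word
  \<open>w\<close> acts with \<open>w ^ N(w) = 1\<close>, where \<open>N(w) = p ^ (n + 2)\<close> and \<open>n\<close> is the position of \<open>w\<close> in an
  enumeration of all words. The group \<open>Q\<close> of words modulo equal behaviour in all admissible
  actions is a residually finite \<open>p\<close>-group. (Positive words suffice: inverses are powers.)

  Let \<open>H\<close> have index \<open>q\<close> in \<open>Q\<close> and be generated by \<open>k\<close> elements. Consider functions from the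
  \<open>2 q\<close> edges of the Schreier graph on the cosets of \<open>H\<close> to the integers mod \<open>p\<close>. Such a function sums to zero
  along every closed path labelled by a relator as soon as, for every \<open>w\<close>, it does so on every
  \<open>w\<close>-orbit of full length \<open>N(w)\<close>: on a shorter orbit the relator runs a multiple of \<open>p\<close> times around it.
  Hence there are at most \<open>\<Sum>w. q / N(w) \<le> q / 2\<close> conditions. Require in addition zero sums along
  paths for the \<open>k\<close> generators of \<open>H\<close> and along one path from the base coset to each of the other
  \<open>q - 1\<close> cosets. Were \<open>q / 2 + k + (q - 1) < 2 q\<close>, a nonzero function \<open>e\<close> would remain. The
  skew product of the coset action with the integers mod \<open>p\<close> along \<open>e\<close> is again admissible, so path sums of \<open>e\<close>
  depend only on the element of \<open>Q\<close>. They define a homomorphism on \<open>H\<close>, which vanishes on generators,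
  and this forces \<open>e = 0\<close>. So \<open>(k - 1) / q \<ge> 1 / 2\<close>; this also excludes that \<open>Q\<close> is finite, where
  \<open>H\<close> trivial and \<open>k = 0\<close> would be possible.
\<close>

section \<open>Small solutions of linear conditions modulo \<open>p\<close>\<close>

text \<open>Pigeonhole: there are \<open>p ^ card E\<close> functions from \<open>E\<close> to
  residues but only \<open>p ^ card I\<close> value vectors, so two distinct functions agree under
  all of \<open>I\<close> modulo \<open>p\<close>, and their difference is the solution.\<close>

lemma small_solution_mod:
  fixes p :: nat and I :: "(('e \<Rightarrow> int) \<Rightarrow> int) set"
  assumes "p > 1" "finite E" "finite I" "card I < card E"
    and additive: "\<And>L c c'. L \<in> I \<Longrightarrow> L (\<lambda>x. c x - c' x) = L c - L c'"
  obtains e where "\<forall>L\<in>I. int p dvd L e" "\<exists>x\<in>E. \<not> int p dvd e x"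
proof -
  define C where "C = E \<rightarrow>\<^sub>E {0..<int p}"
  define D where "D = I \<rightarrow>\<^sub>E {0..<int p}"
  define \<Phi> where "\<Phi> = (\<lambda>c. restrict (\<lambda>L. L c mod int p) I)"
  have "card D < card C"
    unfolding C_def D_def using assms by (simp add: card_funcsetE)
  moreover have "finite D"
    unfolding D_def using assms by (intro finite_PiE) auto
  moreover have "\<Phi> ` C \<subseteq> D"
    unfolding \<Phi>_def D_def using \<open>p > 1\<close> by auto
  ultimately have "\<not> inj_on \<Phi> C"
    using card_inj_on_le by (metis not_le)
  then obtain c c' where c: "c \<in> C" "c' \<in> C" "c \<noteq> c'" "\<Phi> c = \<Phi> c'"
    unfolding inj_on_def by blast
  show thesis
  proof (rule that[of "\<lambda>x. c x - c' x"])
    show "\<forall>L\<in>I. int p dvd L (\<lambda>x. c x - c' x)"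
    proof
      fix L assume L: "L \<in> I"
      have "\<Phi> c L = \<Phi> c' L" using c by simp
      then have "L c mod int p = L c' mod int p" using L by (simp add: \<Phi>_def)
      then show "int p dvd L (\<lambda>x. c x - c' x)"
        using additive[OF L] by (simp add: mod_eq_dvd_iff)
    qed
    obtain x where x: "c x \<noteq> c' x" using c by blast
    \<comment> \<open>Outside \<open>E\<close> both functions take the same default value.\<close>
    have xE: "x \<in> E" using c(1,2) x unfolding C_def by (metis PiE_arb)
    then have "c x \<in> {0..<int p}" "c' x \<in> {0..<int p}" using c(1,2) unfolding C_def by auto
    then have "\<not> int p dvd c x - c' x"
      using x by (metis atLeastLessThan_iff mod_eq_dvd_iff mod_pos_pos_trivial)
    then show "\<exists>x\<in>E. \<not> int p dvd c x - c' x" using xE by blast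
  qed
qed

section \<open>Full orbits, and sums along shorter ones\<close>

definition orb :: "('v \<Rightarrow> 'v) \<Rightarrow> nat \<Rightarrow> 'v \<Rightarrow> 'v set" where
  "orb f N v = (\<lambda>i. (f ^^ i) v) ` {..<N}"

text \<open>Exponents can be reduced modulo \<open>N\<close>, so the orbit is a cycle and can be
  started at any of its points. Hence orbits that meet coincide.\<close>

lemma orb_eqI:
  assumes "(f ^^ N) v = v" "x \<in> orb f N v"
  shows "orb f N x = orb f N v"
proof -
  obtain i where i: "i < N" "x = (f ^^ i) v" using assms(2) by (auto simp: orb_def)
  have sub: "orb f N y \<subseteq> orb f N z" if "(f ^^ N) z = z" "y = (f ^^ j) z" "j < N" for y z j
  proof
    fix t assume "t \<in> orb f N y"
    then obtain k where "t = (f ^^ k) y" by (auto simp: orb_def)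
    then have "t = (f ^^ (k + j)) z" using that by (simp add: funpow_add)
    then have "t = (f ^^ ((k + j) mod N)) z" using that(1) by (simp add: funpow_mod_eq)
    then show "t \<in> orb f N z" using that(3) by (auto simp: orb_def)
  qed
  have x: "(f ^^ N) x = x"
    using assms(1) i(2) by (metis add.commute comp_apply funpow_add)
  have "v = (f ^^ ((N - i) mod N)) x"
  proof -
    have "(f ^^ (N - i)) x = (f ^^ (N - i + i)) v" using i(2) by (simp only: funpow_add comp_apply)
    then have "(f ^^ (N - i)) x = v" using assms(1) i(1) by simp
    then show ?thesis using funpow_mod_eq[OF x] by simp
  qed
  then have "orb f N v \<subseteq> orb f N x" using sub[OF x] i(1) by simp
  moreover have "orb f N x \<subseteq> orb f N v" using sub[OF assms(1) i(2,1)] .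
  ultimately show ?thesis by blast
qed

definition long_orbits :: "('v \<Rightarrow> 'v) \<Rightarrow> nat \<Rightarrow> 'v set \<Rightarrow> 'v set set" where
  "long_orbits f N V = {B. \<exists>v\<in>V. B = orb f N v \<and> card B = N}"

lemma finite_long_orbits: "finite V \<Longrightarrow> finite (long_orbits f N V)"
  by (rule finite_subset[of _ "orb f N ` V"]) (auto simp: long_orbits_def)

text \<open>Long orbits are pairwise disjoint subsets of \<open>V\<close> with \<open>N\<close>
  elements each.\<close>

lemma card_long_orbits:
  assumes "finite V" "f ` V \<subseteq> V" "\<And>v. v \<in> V \<Longrightarrow> (f ^^ N) v = v"
  shows "N * card (long_orbits f N V) \<le> card V"
proof -
  have pow: "(f ^^ i) v \<in> V" if "v \<in> V" for i v
    using that assms(2) by (induction i) auto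
  have "N * card (long_orbits f N V) = (\<Sum>B\<in>long_orbits f N V. card B)"
    by (simp add: long_orbits_def)
  also have "\<dots> = card (\<Union> (long_orbits f N V))"
  proof (rule card_Union_disjoint[symmetric])
    show "pairwise disjnt (long_orbits f N V)"
    proof (rule pairwiseI)
      fix A B assume AB: "A \<in> long_orbits f N V" "B \<in> long_orbits f N V" "A \<noteq> B"
      then obtain a b where "a \<in> V" "b \<in> V" "A = orb f N a" "B = orb f N b"
        by (auto simp: long_orbits_def)
      then show "disjnt A B"
        using AB(3) orb_eqI[OF assms(3)] unfolding disjnt_iff by metis
    qed
    show "\<And>A. A \<in> long_orbits f N V \<Longrightarrow> finite A"
      unfolding long_orbits_def orb_def by blast
  qed
  also have "\<dots> \<le> card V"
    unfolding long_orbits_def orb_def using pow assms(1) by (intro card_mono) blast+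
  finally show ?thesis .
qed

text \<open>A repetition among the first \<open>p ^ n\<close> iterates gives a period
  \<open>d\<close> that properly divides \<open>p ^ n\<close>. So \<open>p * d\<close> divides
  \<open>p ^ n\<close>, and the sum over one period is counted a multiple of \<open>p\<close>
  times.\<close>

lemma sum_short_orbit_dvd:
  fixes g :: "'v \<Rightarrow> int"
  assumes "Factorial_Ring.prime p" "(f ^^ (p ^ n)) v = v" "card (orb f (p ^ n) v) \<noteq> p ^ n"
  shows "int p dvd (\<Sum>i<p ^ n. g ((f ^^ i) v))"
proof -
  define N where "N = p ^ n"
  have "\<not> inj_on (\<lambda>i. (f ^^ i) v) {..<N}"
    using assms(3) card_image[of "\<lambda>i. (f ^^ i) v" "{..<N}"] by (auto simp: orb_def N_def)
  then obtain i j where ij: "i < j" "j < N" "(f ^^ i) v = (f ^^ j) v"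
    unfolding inj_on_def by (metis lessThan_iff linorder_neqE_nat)
  \<comment> \<open>Since \<open>f\<close> need not be injective, the first \<open>i\<close> steps
    are undone by going on for \<open>N - i\<close> more, which completes the cycle.\<close>
  have per: "(f ^^ (j - i)) v = v"
  proof -
    have "(f ^^ (N - i)) ((f ^^ i) v) = (f ^^ (N - i)) ((f ^^ j) v)" using ij by simp
    then have "(f ^^ (N - i + i)) v = (f ^^ (N - i + j)) v" by (simp only: funpow_add comp_apply)
    moreover have "N - i + i = N" "N - i + j = (j - i) + N" using ij by auto
    ultimately have "(f ^^ N) v = (f ^^ (j - i)) ((f ^^ N) v)" by (simp only: funpow_add comp_apply)
    then show ?thesis using assms(2) by (simp add: N_def)
  qed
  have mult: "(f ^^ (y * b)) v = v" if "(f ^^ b) v = v" for b y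
    using that by (induction y) (simp_all add: funpow_add)
  \<comment> \<open>By Bezout the gcd of two periods is again a period.\<close>
  define d where "d = gcd (j - i) N"
  have d: "(f ^^ d) v = v"
  proof -
    obtain x y where "(j - i) * x = N * y + gcd (j - i) N"
      using bezout_nat[of "j - i" N] ij by auto
    then have "x * (j - i) = d + y * N" by (simp add: d_def mult.commute add.commute)
    then show ?thesis
      using mult[OF per, of x] mult[of N y] assms(2) by (simp add: N_def funpow_add)
  qed
  have "d dvd p ^ n" "d \<le> j - i" using ij by (auto simp: d_def N_def intro!: dvd_imp_le)
  then obtain m where m: "m \<le> n" "d = p ^ m" using assms(1) divides_primepow_nat by blast
  with \<open>d \<le> j - i\<close> ij have "m < n" by (metis N_def le_neq_implies_less less_imp_diff_less not_le)
  then obtain k where k: "N = (p * p ^ k) * d"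
    using m by (metis N_def add.commute add_Suc_right less_imp_Suc_add power_Suc power_add)
  have "(\<Sum>i<(p * p ^ k) * d. g ((f ^^ i) v)) = (\<Sum>l<p * p ^ k. \<Sum>i = l * d..<l * d + d. g ((f ^^ i) v))"
    by (rule sum.nat_group[symmetric])
  also have "\<dots> = (\<Sum>l<p * p ^ k. \<Sum>i<d. g ((f ^^ i) v))"
  proof (rule sum.cong[OF refl])
    fix l
    have "(\<Sum>i = l * d..<l * d + d. g ((f ^^ i) v)) = (\<Sum>i = 0..<d. g ((f ^^ (i + l * d)) v))"
      using sum.shift_bounds_nat_ivl[of "\<lambda>i. g ((f ^^ i) v)" 0 "l * d" d] by (simp add: add.commute)
    then show "(\<Sum>i = l * d..<l * d + d. g ((f ^^ i) v)) = (\<Sum>i<d. g ((f ^^ i) v))"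
      using mult[OF d] by (simp add: funpow_add atLeast0LessThan)
  qed
  finally show ?thesis using k by (simp add: N_def)
qed

section \<open>Path sums and skew products\<close>

text \<open>The pair \<open>(v, x)\<close> stands for the edge from \<open>v\<close> to
  \<open>s x v\<close> with label \<open>x\<close>.\<close>

fun path_sum :: "('x \<Rightarrow> 'v \<Rightarrow> 'v) \<Rightarrow> ('v \<times> 'x \<Rightarrow> int) \<Rightarrow> 'v \<Rightarrow> 'x list \<Rightarrow> int" where
  "path_sum s c v [] = 0"
| "path_sum s c v (x # w) = c (v, x) + path_sum s c (s x v) w"

lemma path_sum_append:
  "path_sum s c v (u @ w) = path_sum s c v u + path_sum s c (fold s u v) w"
  by (induction u arbitrary: v) auto

lemma path_sum_diff:
  "path_sum s (\<lambda>x. c x - c' x) v w = path_sum s c v w - path_sum s c' v w"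
  by (induction w arbitrary: v) auto

abbreviation wpow :: "'x list \<Rightarrow> nat \<Rightarrow> 'x list" where
  "wpow w k \<equiv> concat (replicate k w)"

lemma fold_wpow: "fold s (wpow w k) = fold s w ^^ k"
  by (induction k) (simp_all add: funpow_swap1 fun_eq_iff)

lemma path_sum_wpow:
  "path_sum s c v (wpow w k) = (\<Sum>i<k. path_sum s c ((fold s w ^^ i) v) w)"
proof (induction k)
  case (Suc k)
  have "wpow w (Suc k) = wpow w k @ w" 
    by (simp flip: replicate_append_same)
  then show ?case using Suc by (simp add: path_sum_append fold_wpow)
qed simp

definition skew :: "nat \<Rightarrow> ('x \<Rightarrow> 'v \<Rightarrow> 'v) \<Rightarrow> ('v \<times> 'x \<Rightarrow> int) \<Rightarrow> 'x \<Rightarrow> 'v \<times> int \<Rightarrow> 'v \<times> int" where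
  "skew p s e x = (\<lambda>(v, a). (s x v, (a + e (v, x)) mod int p))"

text \<open>The bounds on \<open>a\<close> are what the empty word requires, as it performs no
  reduction modulo \<open>p\<close>.\<close>

lemma fold_skew:
  "0 \<le> a \<Longrightarrow> a < int p \<Longrightarrow>
    fold (skew p s e) w (v, a) = (fold s w v, (a + path_sum s e v w) mod int p)"
proof (induction w arbitrary: v a)
  case (Cons x w)
  then have "p > 0" by linarith
  then show ?case using Cons.IH[of "(a + e (v, x)) mod int p" "s x v"]
    by (simp add: skew_def mod_add_left_eq add.assoc)
qed simp

section \<open>Finite generation of subgroups of finite index\<close>

text \<open>Schreier's lemma, for a set \<open>X\<close> that generates \<open>G\<close> as a monoid.\<close>

lemma (in group) finite_index_imp_finitely_generated:
  assumes "finite X" "X \<subseteq> carrier G" "subgroup H G" "finite (rcosets H)"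
    and words: "\<And>a. a \<in> carrier G \<Longrightarrow> \<exists>l. set l \<subseteq> X \<and> a = foldr (\<otimes>) l \<one>"
  shows "\<exists>S. finite S \<and> S \<subseteq> H \<and> generate G S = H"
proof -
  interpret H: subgroup H G by fact
  \<comment> \<open>Choosing \<one> for the coset \<open>H\<close> itself makes both representatives
    vanish at the end, when \<open>gen\<close> is applied to \<open>H\<close> and a word for an
    element of \<open>H\<close>.\<close>
  define \<tau> where "\<tau> v = (if v = H then \<one> else SOME g. g \<in> v)" for v
  have \<tau>: "\<tau> v \<in> v" if v: "v \<in> rcosets H" for v
  proof -
    have "v \<noteq> {}" using v H.rcosets_non_empty by blast
    then show ?thesis by (auto simp: \<tau>_def some_in_eq)
  qed
  have Hin: "H \<in> rcosets H" using H.subgroup_in_rcosets[OF is_group] .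
  have cl: "v #> a \<in> rcosets H" if "v \<in> rcosets H" "a \<in> carrier G" for v a
    using that by (auto simp: RCOSETS_def coset_mult_assoc H.subset)
  have sub: "v \<subseteq> carrier G" if "v \<in> rcosets H" for v
    using that H.rcosets_carrier[OF is_group] by blast
  define S where "S = (\<lambda>(v, x). \<tau> v \<otimes> x \<otimes> inv (\<tau> (v #> x))) ` ((rcosets H) \<times> X)"
  have fin: "finite S" using assms by (simp add: S_def)
  have SH: "S \<subseteq> H"
  proof
    fix a assume "a \<in> S"
    then obtain v x where vx: "v \<in> rcosets H" "x \<in> X" "a = \<tau> v \<otimes> x \<otimes> inv (\<tau> (v #> x))"
      by (auto simp: S_def)
    have x: "x \<in> carrier G" using vx assms by auto
    have vx': "v #> x \<in> rcosets H" using cl vx x by blast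
    have "\<tau> v \<otimes> x \<in> v #> x" using \<tau>[OF vx(1)] by (auto simp: r_coset_def)
    moreover have "\<tau> (v #> x) \<in> v #> x" using \<tau>[OF vx'] .
    moreover have "\<tau> v \<otimes> x \<in> carrier G" "\<tau> (v #> x) \<in> carrier G"
      using sub[OF vx(1)] sub[OF vx'] \<tau>[OF vx(1)] \<tau>[OF vx'] x by auto
    moreover have "v #> x = H #> \<tau> (v #> x)"
      using vx' \<tau>[OF vx'] repr_independence[OF _ _ H.subgroup_axioms] by (auto simp: RCOSETS_def)
    ultimately show "a \<in> H"
      using vx(3) H.rcos_module[OF is_group] by metis
  qed
  \<comment> \<open>Each letter contributes one Schreier generator from \<open>S\<close>; the
    representatives between consecutive letters cancel.\<close>
  have gen: "\<tau> v \<otimes> foldr (\<otimes>) l \<one> \<otimes> inv (\<tau> (v #> foldr (\<otimes>) l \<one>)) \<in> generate G S"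
    if "v \<in> rcosets H" "set l \<subseteq> X" for v l
    using that
  proof (induction l arbitrary: v)
    case Nil
    have "\<tau> v \<in> carrier G" using sub \<tau> Nil by blast
    then show ?case using Nil sub[of v] generate.one by (simp add: coset_mult_one)
  next
    case (Cons x l)
    define y where "y = foldr (\<otimes>) l \<one>"
    have fc: "set l \<subseteq> carrier G \<Longrightarrow> foldr (\<otimes>) l \<one> \<in> carrier G" for l
      by (induction l) auto
    have x: "x \<in> carrier G" "y \<in> carrier G" using Cons.prems assms(2) fc[of l] by (auto simp: y_def)
    have vx: "v #> x \<in> rcosets H" "v #> x #> y \<in> rcosets H" using cl Cons.prems x by auto
    have c: "\<tau> v \<in> carrier G" "\<tau> (v #> x) \<in> carrier G" "\<tau> (v #> x #> y) \<in> carrier G"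
      using sub \<tau> vx Cons.prems by blast+
    have "\<tau> v \<otimes> x \<otimes> inv (\<tau> (v #> x)) \<in> generate G S"
      using Cons.prems by (intro generate.incl) (auto simp: S_def)
    moreover have "\<tau> (v #> x) \<otimes> y \<otimes> inv (\<tau> (v #> x #> y)) \<in> generate G S"
      using Cons.IH[OF vx(1)] Cons.prems by (simp add: y_def)
    ultimately have "\<tau> v \<otimes> x \<otimes> inv (\<tau> (v #> x)) \<otimes> (\<tau> (v #> x) \<otimes> y \<otimes> inv (\<tau> (v #> x #> y))) \<in> generate G S"
      by (rule generate.eng)
    also have "\<tau> v \<otimes> x \<otimes> inv (\<tau> (v #> x)) \<otimes> (\<tau> (v #> x) \<otimes> y \<otimes> inv (\<tau> (v #> x #> y)))
        = \<tau> v \<otimes> (x \<otimes> y) \<otimes> inv (\<tau> (v #> x #> y))"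
      using c x by (simp add: m_assoc inv_solve_left')
    also have "v #> x #> y = v #> (x \<otimes> y)"
      using sub[OF Cons.prems(1)] x by (simp add: coset_mult_assoc)
    finally show ?case by (simp add: y_def)
  qed
  have "H \<subseteq> generate G S"
  proof
    fix h assume h: "h \<in> H"
    then obtain l where l: "set l \<subseteq> X" "h = foldr (\<otimes>) l \<one>" using words H.subset by blast
    have "H #> h = H" using h coset_join2[OF _ H.subgroup_axioms] H.subset by blast
    then show "h \<in> generate G S" using gen[OF Hin l(1)] h l(2) H.subset by (auto simp: \<tau>_def)
  qed
  moreover have "generate G S \<subseteq> H" using generate_subgroup_incl[OF SH H.subgroup_axioms] .
  ultimately show ?thesis using fin SH by blast
qed

section \<open>The group of words and its torsion\<close>

locale torsion_words =
  fixes p :: nat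
  assumes p: "Factorial_Ring.prime p"
begin

text \<open>The summand 2 bounds the reciprocals by 1/4, 1/8, ..., so that they add up to at most
  1/2.\<close>

definition exponent :: "bool list \<Rightarrow> nat" where
  "exponent w = p ^ (to_nat w + 2)"

text \<open>Letters act from left to right along a word. Each permutes \<open>V\<close>, because the
  condition for a one-letter word makes a positive power of it the identity there.\<close>

definition torsion_action :: "'v set \<Rightarrow> (bool \<Rightarrow> 'v \<Rightarrow> 'v) \<Rightarrow> bool" where
  "torsion_action V s \<longleftrightarrow> finite V \<and> (\<forall>x. s x ` V \<subseteq> V) \<and>
     (\<forall>w. \<forall>v\<in>V. (fold s w ^^ exponent w) v = v)"

definition word_equiv :: "bool list \<Rightarrow> bool list \<Rightarrow> bool" where
  "word_equiv u w \<longleftrightarrow>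
     (\<forall>(V :: nat set) s. torsion_action V s \<longrightarrow> (\<forall>v\<in>V. fold s u v = fold s w v))"

lemma word_equiv_refl [simp]: "word_equiv w w"
  and word_equiv_sym: "word_equiv u w \<Longrightarrow> word_equiv w u"
  and word_equiv_trans [trans]: "word_equiv u v \<Longrightarrow> word_equiv v w \<Longrightarrow> word_equiv u w"
  by (simp_all add: word_equiv_def)

lemma fold_closed: "torsion_action V s \<Longrightarrow> v \<in> V \<Longrightarrow> fold s w v \<in> V"
  by (induction w arbitrary: v) (auto simp: torsion_action_def image_subset_iff)

text \<open>
  \<^const>\<open>word_equiv\<close> only quantifies over actions on sets of natural numbers; transport along an
  enumeration of \<open>V\<close> extends it to all types.
\<close>

lemma word_equiv_fold:
  assumes eq: "word_equiv u w" and V: "torsion_action (V :: 'v set) s" "v \<in> V"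
  shows "fold s u v = fold s w v"
proof -
  obtain h where h: "bij_betw h V {..<card V}"
    using V(1) ex_bij_betw_finite_nat[of V] by (auto simp: torsion_action_def atLeast0LessThan)
  define h' where "h' = inv_into V h"
  have h'h: "h' (h v) = v" if "v \<in> V" for v
    using h that by (simp add: h'_def bij_betw_inv_into_left)
  define s' where "s' x a = h (s x (h' a))" for x a
  have conj: "fold s' w (h v) = h (fold s w v)" if "v \<in> V" for w v
    using that
  proof (induction w arbitrary: v)
    case (Cons x w)
    then have "s x v \<in> V" using V(1) by (auto simp: torsion_action_def)
    then show ?case using Cons by (simp add: s'_def h'h)
  qed simp
  have img: "h ` V = {..<card V}" using h by (simp add: bij_betw_def)
  have "torsion_action {..<card V} s'"
    unfolding torsion_action_def
  proof (intro conjI allI ballI)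
    fix x show "s' x ` {..<card V} \<subseteq> {..<card V}"
      using V(1) h'h by (auto simp: s'_def torsion_action_def image_subset_iff simp flip: img)
  next
    fix w a assume "a \<in> {..<card V}"
    then obtain v where v: "v \<in> V" "a = h v" using img by blast
    have "(fold s' w ^^ exponent w) a = h ((fold s w ^^ exponent w) v)"
      using conj[OF v(1), of "wpow w (exponent w)"] v(2) by (simp add: fold_wpow)
    then show "(fold s' w ^^ exponent w) a = a" using V(1) v by (simp add: torsion_action_def)
  qed simp
  moreover have "h v \<in> {..<card V}" using V img by blast
  ultimately have "fold s' u (h v) = fold s' w (h v)" using eq by (auto simp: word_equiv_def)
  then have "h (fold s u v) = h (fold s w v)" using conj V by simp
  then show ?thesis using h'h fold_closed[OF V] by metis
qed

lemma word_equiv_append: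
  "word_equiv u u' \<Longrightarrow> word_equiv w w' \<Longrightarrow> word_equiv (u @ w) (u' @ w')"
  using fold_closed by (fastforce simp: word_equiv_def)

lemma word_equiv_wpow: "word_equiv (wpow w (exponent w)) []"
  by (simp add: word_equiv_def fold_wpow torsion_action_def)

text \<open>Elements of \<open>Q\<close> are encoded as the number of a chosen representative word.\<close>

definition code :: "bool list \<Rightarrow> nat" where
  "code w = to_nat (SOME u. word_equiv w u)"

definition word :: "nat \<Rightarrow> bool list" where
  "word = from_nat"

lemma word_code: "word_equiv (word (code w)) w"
proof -
  have "word_equiv w (SOME u. word_equiv w u)"
    by (rule someI[of _ w]) simp
  then show ?thesis by (simp add: word_def code_def word_equiv_sym)
qed

lemma code_eq_iff: "code u = code w \<longleftrightarrow> word_equiv u w"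
proof
  assume "code u = code w"
  then show "word_equiv u w" using word_code[of u] word_code[of w]
    by (metis word_equiv_sym word_equiv_trans)
next
  assume "word_equiv u w"
  then have "word_equiv u = word_equiv w"
    by (blast intro: word_equiv_sym word_equiv_trans)
  then show "code u = code w" by (simp add: code_def)
qed

definition Q :: "nat monoid" where
  "Q = \<lparr>carrier = range code, mult = (\<lambda>a b. code (word a @ word b)), one = code []\<rparr>"

lemma carrier_Q: "carrier Q = range code"
  and one_Q: "\<one>\<^bsub>Q\<^esub> = code []"
  by (simp_all add: Q_def)

lemma code_append: "code (u @ w) = code u \<otimes>\<^bsub>Q\<^esub> code w"
proof -
  have "word_equiv (word (code u) @ word (code w)) (u @ w)"
    by (intro word_equiv_append word_code)
  then show ?thesis by (simp add: Q_def code_eq_iff word_equiv_sym)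
qed

text \<open>The inverse of \<open>w\<close> is its power with exponent
  \<open>exponent w - 1\<close>.\<close>

lemma group_Q: "group Q"
proof (rule groupI)
  fix a assume "a \<in> carrier Q"
  then obtain w where w: "a = code w" by (auto simp: carrier_Q)
  have "exponent w > 0" using p by (simp add: exponent_def prime_gt_0_nat)
  then obtain m where m: "exponent w = Suc m" using gr0_implies_Suc by blast
  have "code (wpow w m @ w) = code []"
    using word_equiv_wpow[of w] by (simp add: code_eq_iff m flip: replicate_append_same)
  then show "\<exists>b\<in>carrier Q. b \<otimes>\<^bsub>Q\<^esub> a = \<one>\<^bsub>Q\<^esub>"
    by (auto simp: carrier_Q one_Q w code_append)
qed (auto simp: carrier_Q one_Q simp flip: code_append)

sublocale Q: group Q by (rule group_Q)

lemma code_closed [simp]: "code w \<in> carrier Q"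
  by (simp add: carrier_Q)

lemma code_wpow: "code (wpow w k) = code w [^]\<^bsub>Q\<^esub> k"
proof (induction k)
  case (Suc k)
  have "code (wpow w (Suc k)) = code (wpow w k @ w)" by (simp flip: replicate_append_same)
  then show ?case using Suc by (simp add: code_append)
qed (simp add: one_Q)

lemma code_pow_exponent: "code w [^]\<^bsub>Q\<^esub> exponent w = \<one>\<^bsub>Q\<^esub>"
  unfolding code_wpow[symmetric] one_Q code_eq_iff by (rule word_equiv_wpow)

text \<open>The word \<open>u\<close> leads back along any path labelled \<open>w\<close>; it serves
  below to close paths without formal inverses.\<close>

lemma inv_code: obtains u where "inv\<^bsub>Q\<^esub> (code w) = code u" "word_equiv (w @ u) []"
proof -
  obtain u where u: "inv\<^bsub>Q\<^esub> (code w) = code u"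
    using Q.inv_closed[OF code_closed] by (auto simp: carrier_Q)
  have "code (w @ u) = code []" using u by (simp add: code_append one_Q flip: u)
  then show thesis using that[OF u] by (simp add: code_eq_iff)
qed

lemma p_group_Q: "p_group p Q"
  unfolding p_group_def
proof (intro conjI ballI group_Q)
  fix a assume "a \<in> carrier Q"
  then obtain w where w: "a = code w" by (auto simp: carrier_Q)
  have "Q.ord a dvd p ^ (to_nat w + 2)"
    using code_pow_exponent[of w] by (simp add: w Q.pow_eq_id[symmetric] exponent_def)
  then show "\<exists>k. Q.ord a = p ^ k" using p divides_primepow_nat by blast
qed

definition generators :: "nat set" where
  "generators = range (\<lambda>x. code [x])"

text \<open>Supplies the generation as a monoid that Schreier's lemma asks for.\<close>

lemma code_foldr: "code w = foldr (\<otimes>\<^bsub>Q\<^esub>) (map (\<lambda>x. code [x]) w) \<one>\<^bsub>Q\<^esub>"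
proof (induction w)
  case (Cons x w)
  then show ?case using code_append[of "[x]" w] by simp
qed (simp add: one_Q)

lemma finite_index_Q_finitely_generated:
  assumes "subgroup H Q" "finite (rcosets\<^bsub>Q\<^esub> H)"
  shows "\<exists>S. finite S \<and> S \<subseteq> H \<and> generate Q S = H"
proof (rule Q.finite_index_imp_finitely_generated[OF _ _ assms])
  show "finite generators" "generators \<subseteq> carrier Q" by (auto simp: generators_def)
  fix a assume "a \<in> carrier Q"
  then obtain w where "a = code w" by (auto simp: carrier_Q)
  then show "\<exists>l. set l \<subseteq> generators \<and> a = foldr (\<otimes>\<^bsub>Q\<^esub>) l \<one>\<^bsub>Q\<^esub>"
    by (intro exI[of _ "map (\<lambda>x. code [x]) w"]) (auto simp: code_foldr[of w] generators_def)
qed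

lemma rcosets_carrier_Q: "rcosets\<^bsub>Q\<^esub> (carrier Q) = {carrier Q}"
  using Q.coset_join2[OF _ Q.subgroup_self] by (auto simp: RCOSETS_def)

lemma finitely_generated_Q: "finitely_generated_group Q"
  unfolding finitely_generated_group_def
  using finite_index_Q_finitely_generated[OF Q.subgroup_self] group_Q
  by (auto simp: rcosets_carrier_Q)

section \<open>Residual finiteness\<close>

text \<open>A nontrivial element moves a point in some admissible action. The kernel of that action
  is normal, and has finite index because a coset is determined by the induced self-map of the
  finite set \<open>V\<close>.\<close>

lemma residually_finite_Q: "residually_finite Q"
  unfolding residually_finite_def
proof (intro conjI ballI impI group_Q)
  fix a assume "a \<in> carrier Q" "a \<noteq> \<one>\<^bsub>Q\<^esub>"
  then obtain w where w: "a = code w" "code w \<noteq> code []"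
    by (auto simp: carrier_Q one_Q)
  then obtain V :: "nat set" and s v
    where V: "torsion_action V s" and v: "v \<in> V" "fold s w v \<noteq> v"
    by (auto simp: code_eq_iff word_equiv_def)
  define N where "N = {code u |u. \<forall>v\<in>V. fold s u v = v}"
  \<comment> \<open>Membership in the kernel can be tested on any word representing the
    element.\<close>
  have code_N: "code u \<in> N \<longleftrightarrow> (\<forall>v\<in>V. fold s u v = v)" for u
  proof
    assume "code u \<in> N"
    then obtain t where "word_equiv u t" "\<forall>v\<in>V. fold s t v = v"
      by (auto simp: N_def code_eq_iff)
    then show "\<forall>v\<in>V. fold s u v = v" using word_equiv_fold[OF _ V] by metis
  qed (auto simp: N_def)
  have inv_fold: "\<exists>u. inv\<^bsub>Q\<^esub> (code t) = code u \<and> (\<forall>v\<in>V. fold s u (fold s t v) = v)" for t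
    by (rule inv_code[of t]) (use word_equiv_fold[OF _ V] in fastforce)
  have sub: "subgroup N Q"
  proof (rule Q.subgroupI)
    show "N \<subseteq> carrier Q" by (auto simp: N_def)
    show "N \<noteq> {}" using code_N[of "[]"] by auto
    fix a assume "a \<in> N"
    then obtain t where t: "a = code t" "\<forall>v\<in>V. fold s t v = v" by (auto simp: N_def)
    then show "inv\<^bsub>Q\<^esub> a \<in> N" using inv_fold[of t] code_N by auto
  next
    fix a b assume "a \<in> N" "b \<in> N"
    then obtain t u where "a = code t" "b = code u"
      "\<forall>v\<in>V. fold s t v = v" "\<forall>v\<in>V. fold s u v = v" by (auto simp: N_def)
    then show "a \<otimes>\<^bsub>Q\<^esub> b \<in> N" by (simp add: code_N flip: code_append)
  qed
  have "N \<lhd> Q"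
    unfolding Q.normal_inv_iff
  proof (intro conjI ballI sub)
    fix a b assume "a \<in> carrier Q" "b \<in> N"
    then obtain t u where t: "a = code t" "b = code u" "\<forall>v\<in>V. fold s u v = v"
      by (auto simp: N_def carrier_Q)
    then show "a \<otimes>\<^bsub>Q\<^esub> b \<otimes>\<^bsub>Q\<^esub> inv\<^bsub>Q\<^esub> a \<in> N"
      using inv_fold[of t] fold_closed[OF V] by (auto simp: code_N simp flip: code_append)
  qed
  moreover have "finite (rcosets\<^bsub>Q\<^esub> N)"
  proof -
    define \<rho> where "\<rho> t = restrict (fold s t) V" for t
    have same: "N #>\<^bsub>Q\<^esub> code t = N #>\<^bsub>Q\<^esub> code u" if "\<rho> t = \<rho> u" for t u
    proof -
      have eq: "fold s t v = fold s u v" if "v \<in> V" for v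
        using fun_cong[OF \<open>\<rho> t = \<rho> u\<close>, of v] that by (simp add: \<rho>_def)
      obtain u' where u': "inv\<^bsub>Q\<^esub> (code u) = code u'" "\<forall>v\<in>V. fold s u' (fold s u v) = v"
        using inv_fold by blast
      have "code t \<otimes>\<^bsub>Q\<^esub> inv\<^bsub>Q\<^esub> (code u) \<in> N"
        using u' eq by (simp add: code_N flip: code_append)
      then have "code t \<in> N #>\<^bsub>Q\<^esub> code u"
        using subgroup.rcos_module[OF sub group_Q] by simp
      then show ?thesis using Q.repr_independence[OF _ _ sub] by simp
    qed
    have "finite (\<rho> ` UNIV)"
    proof (rule finite_subset)
      show "range \<rho> \<subseteq> V \<rightarrow>\<^sub>E V" using fold_closed[OF V] by (auto simp: \<rho>_def)
      show "finite (V \<rightarrow>\<^sub>E V)" using V by (auto simp: torsion_action_def intro: finite_PiE)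
    qed
    \<comment> \<open>By \<open>same\<close> the coset depends only on the self-map, so any word
      inducing that map may represent it.\<close>
    moreover have "rcosets\<^bsub>Q\<^esub> N = (\<lambda>r. N #>\<^bsub>Q\<^esub> code (SOME t. \<rho> t = r)) ` range \<rho>"
    proof -
      have "N #>\<^bsub>Q\<^esub> code (SOME t. \<rho> t = \<rho> u) = N #>\<^bsub>Q\<^esub> code u" for u
        by (rule same) (rule someI[of "\<lambda>t. \<rho> t = \<rho> u"], simp)
      then show ?thesis by (auto simp: RCOSETS_def carrier_Q image_image)
    qed
    ultimately show ?thesis by simp
  qed
  moreover have "a \<notin> N" using w v by (auto simp: code_N)
  ultimately show "\<exists>N. N \<lhd> Q \<and> finite (rcosets\<^bsub>Q\<^esub> N) \<and> a \<notin> N" by blast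
qed

section \<open>Counting the cocycle conditions\<close>

text \<open>A pair \<open>(w, B)\<close> indexes the condition that the path sums of
  \<open>w\<close> from the points of \<open>B\<close> add up to zero modulo \<open>p\<close>. An
  orbit longer than \<open>card V\<close> does not exist, so bounding \<open>exponent w\<close>
  loses nothing and makes the set finite.\<close>

definition cocycle_conditions :: "'v set \<Rightarrow> (bool \<Rightarrow> 'v \<Rightarrow> 'v) \<Rightarrow> (bool list \<times> 'v set) set" where
  "cocycle_conditions V s =
     (SIGMA w:{w. exponent w \<le> card V}. long_orbits (fold s w) (exponent w) V)"

lemma finite_exponent_le: "finite {w. exponent w \<le> m}"
proof (rule finite_subset)
  show "{w. exponent w \<le> m} \<subseteq> (to_nat :: bool list \<Rightarrow> nat) -` {..m}"
  proof clarsimp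
    fix w assume "exponent w \<le> m"
    moreover have "p ^ (to_nat w + 2) > to_nat w + 2"
      using prime_gt_1_nat[OF p] by (intro power_gt_expt) auto
    ultimately show "to_nat w \<le> m" by (simp add: exponent_def)
  qed
  show "finite ((to_nat :: bool list \<Rightarrow> nat) -` {..m})"
    by (intro finite_vimageI) auto
qed

lemma finite_cocycle_conditions: "finite V \<Longrightarrow> finite (cocycle_conditions V s)"
  unfolding cocycle_conditions_def
  by (intro finite_SigmaI finite_exponent_le finite_long_orbits)

text \<open>Distinct words have distinct numbers and \<open>p\<close> is at least 2, so a geometric
  series dominates the sum.\<close>

lemma sum_inverse_exponent: "finite W \<Longrightarrow> (\<Sum>w\<in>W. 1 / real (exponent w)) \<le> 1 / 2"
proof -
  assume W: "finite W"
  have "(\<Sum>w\<in>W. 1 / real (exponent w)) \<le> (\<Sum>w\<in>W. (1 / 4) * (1 / 2) ^ to_nat w)"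
  proof (rule sum_mono)
    fix w
    have "2 ^ (to_nat w + 2) \<le> exponent w"
      unfolding exponent_def using prime_ge_2_nat[OF p] by (intro power_mono) auto
    then have "2 ^ (to_nat w + 2) \<le> real (exponent w)" 
      by (metis of_nat_le_iff of_nat_numeral of_nat_power)
    then have "1 / real (exponent w) \<le> 1 / 2 ^ (to_nat w + 2)"
      by (rule frac_le[rotated 3]) auto
    then show "1 / real (exponent w) \<le> (1 / 4) * (1 / 2) ^ to_nat w"
      by (simp add: power_one_over power_add)
  qed
  also have "\<dots> = (\<Sum>j\<in>to_nat ` W. (1 / 4) * (1 / 2) ^ j)"
    by (subst sum.reindex) (auto intro: inj_on_subset[OF inj_to_nat])
  also have "\<dots> \<le> (\<Sum>j. (1 / 4) * (1 / 2 :: real) ^ j)"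
    using W by (intro sum_le_suminf summable_mult summable_geometric) auto
  also have "\<dots> = 1 / 2"
    by (subst suminf_mult) (auto simp: suminf_geometric summable_geometric)
  finally show ?thesis .
qed

text \<open>Each word \<open>w\<close> has at most \<open>card V / exponent w\<close> long orbits;
  sum over \<open>w\<close>.\<close>

lemma card_cocycle_conditions:
  assumes V: "torsion_action V s"
  shows "2 * card (cocycle_conditions V s) \<le> card V"
proof -
  define W where "W = {w. exponent w \<le> card V}"
  have fin: "finite W" "finite V"
    using V finite_exponent_le by (auto simp: W_def torsion_action_def)
  have "real (card (cocycle_conditions V s))
      = (\<Sum>w\<in>W. real (card (long_orbits (fold s w) (exponent w) V)))"
    unfolding cocycle_conditions_def W_def[symmetric]
    using fin finite_long_orbits by (subst card_SigmaI) auto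
  also have "\<dots> \<le> (\<Sum>w\<in>W. real (card V) * (1 / real (exponent w)))"
  proof (rule sum_mono)
    fix w
    have "exponent w * card (long_orbits (fold s w) (exponent w) V) \<le> card V"
      using V fold_closed[OF V] by (intro card_long_orbits) (auto simp: torsion_action_def)
    then have "real (exponent w) * card (long_orbits (fold s w) (exponent w) V) \<le> card V"
      by (metis of_nat_le_iff of_nat_mult)
    moreover have "exponent w > 0" using p by (simp add: exponent_def prime_gt_0_nat)
    ultimately show "card (long_orbits (fold s w) (exponent w) V) \<le> real (card V) * (1 / real (exponent w))"
      by (simp add: field_simps)
  qed
  also have "\<dots> \<le> real (card V) * (1 / 2)"
    unfolding sum_distrib_left[symmetric] by (intro mult_left_mono sum_inverse_exponent fin) auto
  finally show ?thesis by linarith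
qed

text \<open>On a full orbit the relator's path sum is exactly the sum in one of the conditions; on a
  shorter orbit divisibility is automatic by \<open>sum_short_orbit_dvd\<close>.\<close>

lemma path_sum_relator_dvd:
  assumes V: "torsion_action V s" and v: "v \<in> V"
    and cond: "\<forall>(w, B)\<in>cocycle_conditions V s. int p dvd (\<Sum>u\<in>B. path_sum s e u w)"
  shows "int p dvd path_sum s e v (wpow w (exponent w))"
proof -
  define B where "B = orb (fold s w) (exponent w) v"
  have period: "(fold s w ^^ exponent w) v = v" using V v by (simp add: torsion_action_def)
  show ?thesis
  proof (cases "card B = exponent w")
    case True
    then have inj: "inj_on (\<lambda>i. (fold s w ^^ i) v) {..<exponent w}"
      unfolding B_def orb_def by (intro eq_card_imp_inj_on) auto
    have "B \<subseteq> V"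
      using fold_closed[OF V v, of "wpow w _"] unfolding B_def orb_def fold_wpow by auto
    then have "card B \<le> card V" using V by (intro card_mono) (auto simp: torsion_action_def)
    then have "(w, B) \<in> cocycle_conditions V s"
      using True v by (auto simp: cocycle_conditions_def long_orbits_def B_def)
    then have "int p dvd (\<Sum>u\<in>B. path_sum s e u w)" using cond by blast
    then show ?thesis
      unfolding path_sum_wpow B_def orb_def sum.reindex[OF inj] by simp
  next
    case False
    then show ?thesis
      unfolding path_sum_wpow exponent_def
      using p period by (intro sum_short_orbit_dvd) (simp_all only: B_def exponent_def not_False_eq_True)
  qed
qed

section \<open>Path sums as invariants of group elements\<close>

text \<open>A relator returns to its starting point in \<open>V\<close> and changes the second
  coordinate by its path sum, which is zero modulo \<open>p\<close>.\<close>

lemma torsion_action_skew: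
  assumes V: "torsion_action V s"
    and rel: "\<And>v w. v \<in> V \<Longrightarrow> int p dvd path_sum s e v (wpow w (exponent w))"
  shows "torsion_action (V \<times> {0..<int p}) (skew p s e)"
  unfolding torsion_action_def
proof (intro conjI allI ballI)
  show "finite (V \<times> {0..<int p})" using V by (simp add: torsion_action_def)
  show "skew p s e x ` (V \<times> {0..<int p}) \<subseteq> V \<times> {0..<int p}" for x
    using V prime_gt_0_nat[OF p] by (auto simp: skew_def torsion_action_def)
  fix w y assume "y \<in> V \<times> {0..<int p}"
  then obtain v a where y: "y = (v, a)" "v \<in> V" "0 \<le> a" "a < int p" by auto
  have "(a + path_sum s e v (wpow w (exponent w))) mod int p = a"
    using rel[OF y(2), of w] y by (auto elim!: dvdE)
  moreover have "(fold s w ^^ exponent w) v = v" using V y by (simp add: torsion_action_def)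
  ultimately show "(fold (skew p s e) w ^^ exponent w) y = y"
    unfolding fold_wpow[symmetric] y(1) fold_skew[OF y(3,4)] by (simp add: fold_wpow)
qed

text \<open>In the skew product, started at \<open>(v, 0)\<close>, the second coordinate reached is
  the path sum modulo \<open>p\<close>, and equivalent words reach the same point.\<close>

lemma path_sum_cong:
  assumes V: "torsion_action V s" "v \<in> V"
    and rel: "\<And>v w. v \<in> V \<Longrightarrow> int p dvd path_sum s e v (wpow w (exponent w))"
    and eq: "word_equiv u w"
  shows "int p dvd path_sum s e v u - path_sum s e v w"
proof -
  have "p > 0" using prime_gt_0_nat[OF p] .
  then have "(v, 0) \<in> V \<times> {0..<int p}" using V by simp
  then have "fold (skew p s e) u (v, 0) = fold (skew p s e) w (v, 0)"
    using rel by (intro word_equiv_fold[OF eq torsion_action_skew[OF V(1)]])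
  then show ?thesis using \<open>p > 0\<close> by (simp add: fold_skew mod_eq_dvd_iff)
qed

section \<open>Index against number of generators, and the rank gradient\<close>

text \<open>With index \<open>q\<close> and \<open>k\<close> generators this says
  \<open>(k - 1) / q >= 1 / 2\<close>. An empty \<open>S\<close> is allowed, which is what
  \<open>infinite_Q\<close> exploits.\<close>

lemma index_le_generators:
  assumes H: "subgroup H Q" "finite (rcosets\<^bsub>Q\<^esub> H)"
    and S: "finite S" "generate Q S = H" "S \<subseteq> H"
  shows "card (rcosets\<^bsub>Q\<^esub> H) + 2 \<le> 2 * card S"
proof (rule ccontr)
  assume small: "\<not> ?thesis"
  interpret H: subgroup H Q by fact
  define V where "V = rcosets\<^bsub>Q\<^esub> H"
  define s where "s x v = v #>\<^bsub>Q\<^esub> code [x]" for x v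
  have HV: "H \<in> V" using H.subgroup_in_rcosets[OF group_Q] by (simp add: V_def)
  have subV: "v \<subseteq> carrier Q" if "v \<in> V" for v
    using that H.rcosets_carrier[OF group_Q] by (auto simp: V_def)
  have sV: "s x v \<in> V" if "v \<in> V" for x v
    using that by (auto simp: V_def s_def RCOSETS_def Q.coset_mult_assoc H.subset)
  have fold_s: "fold s w v = v #>\<^bsub>Q\<^esub> code w" if "v \<in> V" for w v
    using that
  proof (induction w arbitrary: v)
    case Nil
    then show ?case using Q.coset_mult_one[OF subV] by (simp flip: one_Q)
  next
    case (Cons x w)
    then have "fold s (x # w) v = v #>\<^bsub>Q\<^esub> code [x] #>\<^bsub>Q\<^esub> code w"
      using Cons.IH[OF sV[OF Cons.prems]] by (simp add: s_def[symmetric])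
    also have "\<dots> = v #>\<^bsub>Q\<^esub> code ([x] @ w)"
      using subV[OF Cons.prems] by (simp only: Q.coset_mult_assoc code_closed code_append)
    finally show ?case by simp
  qed
  have V: "torsion_action V s"
    unfolding torsion_action_def
  proof (intro conjI allI ballI)
    show "finite V" using H by (simp add: V_def)
    show "s x ` V \<subseteq> V" for x using sV by blast
    fix w v assume v: "v \<in> V"
    have "v #>\<^bsub>Q\<^esub> code (wpow w (exponent w)) = v"
      using Q.coset_mult_one[OF subV[OF v]] by (simp only: code_wpow code_pow_exponent)
    then show "(fold s w ^^ exponent w) v = v" using fold_s[OF v] by (simp add: fold_wpow[symmetric])
  qed
  \<comment> \<open>\<open>H\<close> is the stabiliser of the base coset: its elements are the
    labels of closed paths there.\<close>
  have mem_H: "code w \<in> H \<longleftrightarrow> fold s w H = H" for w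
    using Q.coset_join1[OF _ code_closed H.subgroup_axioms]
      Q.coset_join2[OF code_closed H.subgroup_axioms] by (auto simp: fold_s[OF HV])
  have "\<exists>w. fold s w H = v" if "v \<in> V" for v
    using that fold_s[OF HV] by (auto simp: V_def RCOSETS_def carrier_Q)
  then obtain t where t: "\<And>v. v \<in> V \<Longrightarrow> fold s (t v) H = v" by metis
  \<comment> \<open>The base coset gets the empty path, whose sum is zero, so \<open>L3\<close>
    needs only \<open>q - 1\<close> conditions.\<close>
  define t' where "t' v = (if v = H then [] else t v)" for v
  have t': "fold s (t' v) H = v" if "v \<in> V" for v using t[OF that] by (simp add: t'_def)

  define L1 where "L1 = (\<lambda>(w, B) e. \<Sum>u\<in>B. path_sum s e u w) ` cocycle_conditions V s"
  define L2 where "L2 = (\<lambda>a e. path_sum s e H (word a)) ` S"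
  define L3 where "L3 = (\<lambda>v e. path_sum s e H (t v)) ` (V - {H})"
  have fin: "finite V" "finite (cocycle_conditions V s)"
    using V finite_cocycle_conditions by (auto simp: torsion_action_def)
  have "card (L1 \<union> L2 \<union> L3) \<le> card L1 + card L2 + card L3"
    by (meson add_le_mono1 card_Un_le le_trans)
  also have "\<dots> \<le> card (cocycle_conditions V s) + card S + card (V - {H})"
    unfolding L1_def L2_def L3_def using fin S by (intro add_mono card_image_le) auto
  \<comment> \<open>With \<open>q = card V\<close>, twice the left side is at most
    \<open>q + (q + 1) + 2 * (q - 1) = 4 * q - 1\<close>, whereas there are \<open>2 * q\<close>
    edges.\<close>
  also have "\<dots> < card (V \<times> (UNIV :: bool set))"
  proof -
    have "card V > 0" using fin HV card_gt_0_iff by blast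
    then show ?thesis
      using small card_cocycle_conditions[OF V] fin HV
      by (simp add: card_cartesian_product V_def[symmetric])
  qed
  finally have "card (L1 \<union> L2 \<union> L3) < card (V \<times> (UNIV :: bool set))" .
  then obtain e where e: "\<forall>L\<in>L1 \<union> L2 \<union> L3. int p dvd L e"
    and nz: "\<exists>y\<in>V \<times> UNIV. \<not> int p dvd e y"
  proof (rule small_solution_mod[rotated 3])
    show "p > 1" using prime_gt_1_nat[OF p] .
    show "finite (V \<times> (UNIV :: bool set))" "finite (L1 \<union> L2 \<union> L3)"
      using fin S by (auto simp: L1_def L2_def L3_def)
    fix L c c' assume "L \<in> L1 \<union> L2 \<union> L3"
    then show "L (\<lambda>x. c x - c' x) = L c - L c'"
      by (auto simp: L1_def L2_def L3_def path_sum_diff sum_subtractf)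
  qed
  have rel: "int p dvd path_sum s e v (wpow w (exponent w))" if "v \<in> V" for v w
    using that e by (intro path_sum_relator_dvd[OF V]) (auto simp: L1_def)
  have cong: "int p dvd path_sum s e v u - path_sum s e v w" if "v \<in> V" "word_equiv u w" for u v w
    using path_sum_cong[OF V that(1) rel that(2)] .
  have H_zero: "int p dvd path_sum s e H w" if "code w \<in> H" for w
  proof -
    \<comment> \<open>Quantifying over all words of an element lets the induction change
      representatives. Path sums add up here because words for elements of \<open>H\<close> return
      to the base coset.\<close>
    have "\<forall>w. a = code w \<longrightarrow> int p dvd path_sum s e H w" if "a \<in> generate Q S" for a
      using that
    proof induction
      case one
      then show ?case using cong[OF HV, of _ "[]"] by (auto simp: one_Q code_eq_iff[symmetric])
    next
      case (incl a)
      have "int p dvd path_sum s e H (word a)" using e incl by (auto simp: L2_def)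
      then show ?case using cong[OF HV] word_code by (metis dvd_diff_commute dvd_diff_right_iff)
    next
      case (inv a)
      show ?case
      proof (intro allI impI)
        fix w assume w: "inv\<^bsub>Q\<^esub> a = code w"
        have a: "a \<in> carrier Q" "a \<in> H" using inv S by auto
        then obtain u where u: "a = code u" by (auto simp: carrier_Q)
        have "int p dvd path_sum s e H (word a)" using e inv by (auto simp: L2_def)
        then have "int p dvd path_sum s e H u"
          using cong[OF HV] word_code[of u] u by (metis dvd_diff_commute dvd_diff_right_iff)
        moreover have "word_equiv (u @ w) []"
          using a u by (simp add: code_eq_iff[symmetric] code_append w[symmetric] one_Q[symmetric])
        then have "int p dvd path_sum s e H (u @ w)" using cong[OF HV] by fastforce
        moreover have "fold s u H = H" using a u mem_H by simp
        ultimately show "int p dvd path_sum s e H w"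
          by (simp add: path_sum_append dvd_add_right_iff)
      qed
    next
      case (eng a b)
      show ?case
      proof (intro allI impI)
        fix w assume w: "a \<otimes>\<^bsub>Q\<^esub> b = code w"
        have ab: "a \<in> H" "b \<in> H" using eng S by auto
        then have "a \<in> range code" "b \<in> range code" using H.subset by (auto simp: carrier_Q)
        then obtain u v where uv: "a = code u" "b = code v" by blast
        have "int p dvd path_sum s e H (u @ v)"
          using eng.IH uv ab mem_H[of u] by (simp add: path_sum_append)
        moreover have "word_equiv (u @ v) w" using w uv by (simp add: code_eq_iff[symmetric] code_append)
        ultimately show "int p dvd path_sum s e H w"
          using cong[OF HV] by (metis dvd_diff_commute dvd_diff_right_iff)
      qed
    qed
    then show ?thesis using that S by blast
  qed
  have t_zero: "int p dvd path_sum s e H (t' v)" if "v \<in> V" for v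
    using that e by (auto simp: t'_def L3_def)
  have "int p dvd e (v, x)" if v: "v \<in> V" for v x
  proof -
    \<comment> \<open>Two closed paths at \<open>H\<close> share the return path \<open>u\<close>:
      one reaches \<open>s x v\<close> directly, the other through \<open>v\<close> and the edge
      \<open>(v, x)\<close>. Both sums vanish modulo \<open>p\<close>, as do those of the chosen
      paths, which leaves \<open>e (v, x)\<close>.\<close>
    obtain u where u: "word_equiv (t' (s x v) @ u) []" by (rule inv_code)
    have x: "fold s (t' (s x v)) H = s x v" using t' sV v by blast
    have loop: "fold s u (s x v) = H"
      using word_equiv_fold[OF u V HV] x by simp
    have "int p dvd path_sum s e H (t' (s x v) @ u)"
      using x loop by (intro H_zero) (simp add: mem_H)
    then have 1: "int p dvd path_sum s e (s x v) u"
      using t_zero[OF sV[OF v], of x] x by (simp add: path_sum_append dvd_add_right_iff)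
    have "int p dvd path_sum s e H (t' v @ [x] @ u)"
      using t'[OF v] loop by (intro H_zero) (simp add: mem_H)
    then have "int p dvd e (v, x) + path_sum s e (s x v) u"
      using t_zero[OF v] t'[OF v] by (simp add: path_sum_append dvd_add_right_iff)
    then show ?thesis using 1 by (simp add: dvd_add_left_iff)
  qed
  then show False using nz by auto
qed

lemma half_le_quotient:
  assumes "finite_index_subgroup H Q"
  shows "1 / 2 \<le> (real (min_generators (Q\<lparr>carrier := H\<rparr>)) - 1) / real (subgroup_index Q H)"
proof -
  have H: "subgroup H Q" "finite (rcosets\<^bsub>Q\<^esub> H)"
    using assms by (auto simp: finite_index_subgroup_def)
  define P where "P n \<longleftrightarrow> (\<exists>S. finite S \<and> card S = n \<and> S \<subseteq> carrier (Q\<lparr>carrier := H\<rparr>) \<and>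
      generate (Q\<lparr>carrier := H\<rparr>) S = carrier (Q\<lparr>carrier := H\<rparr>))" for n
  obtain S where "finite S" "S \<subseteq> H" "generate Q S = H"
    using finite_index_Q_finitely_generated[OF H] by blast
  then have "P (card S)" unfolding P_def using Q.generate_consistent[OF _ H(1)] by auto
  \<comment> \<open>Finite generation ensures that the minimum is attained, so
    \<open>min_generators\<close> is the size of an actual generating set.\<close>
  then have "P (LEAST n. P n)" by (rule LeastI)
  then obtain S where S: "finite S" "card S = min_generators (Q\<lparr>carrier := H\<rparr>)" "S \<subseteq> H" "generate Q S = H"
    unfolding P_def min_generators_def using Q.generate_consistent[OF _ H(1)] by auto
  have "card (rcosets\<^bsub>Q\<^esub> H) + 2 \<le> 2 * card S"
    using index_le_generators[OF H S(1,4,3)] .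
  moreover have "card (rcosets\<^bsub>Q\<^esub> H) > 0"
    using H subgroup.subgroup_in_rcosets[OF H(1) group_Q] card_gt_0_iff by blast
  ultimately show ?thesis
    by (simp add: subgroup_index_def field_simps flip: S(2))
qed

lemma rank_gradient_Q: "rank_gradient Q \<ge> 1 / 2"
  unfolding rank_gradient_def
proof (rule cINF_greatest)
  have "finite_index_subgroup (carrier Q) Q"
    by (simp add: finite_index_subgroup_def Q.subgroup_self rcosets_carrier_Q)
  then show "{H. finite_index_subgroup H Q} \<noteq> {}" by blast
qed (use half_le_quotient in auto)

text \<open>In a finite group the trivial subgroup would have finite index and be generated by the
  empty set, contradicting \<open>index_le_generators\<close>.\<close>

lemma infinite_Q: "infinite (carrier Q)"
proof
  assume "finite (carrier Q)"
  then have "finite (rcosets\<^bsub>Q\<^esub> {\<one>\<^bsub>Q\<^esub>})" by (simp add: RCOSETS_def)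
  then have "card (rcosets\<^bsub>Q\<^esub> {\<one>\<^bsub>Q\<^esub>}) + 2 \<le> 2 * card ({} :: nat set)"
    by (intro index_le_generators Q.triv_subgroup) (auto simp: Q.generate_empty)
  then show False by simp
qed

end

theorem corollary1p2:
  fixes p :: nat
  assumes "Factorial_Ring.prime p"
  shows "\<exists>Q :: nat monoid.
           finitely_generated_group Q \<and> infinite (carrier Q) \<and>
           residually_finite Q \<and> p_group p Q \<and> rank_gradient Q > 0"
proof -
  interpret torsion_words p by unfold_locales (rule assms)
  have "rank_gradient Q > 0" using rank_gradient_Q by linarith
  then show ?thesis
    using finitely_generated_Q infinite_Q residually_finite_Q p_group_Q by blast
qed

end
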